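(* Let $P$ be an $N\times N$ real matrix with non-negative entries and $\rho(P)<1$, let $B\in\mathbb{R}^N$, and consider the two-processor asynchronous distributed D-iteration for $(P,B)$ described in the context. Suppose each processor (PID) applies a fair sequence for diffusions, and suppose there is a constant $T$ such that, for the transmissions in both directions and for all $n\ge1$, $|T_n-T_n'|\le T$ and $|T_n'-T_{n-1}'|\le T$. Then the distributed computation converges to the limit of the sequential single-processor D-iteration: writing $H=(I-P)^{-1}B=([H]^1,[H]^2)$ for the limit of the sequential D-iteration (with any fair sequence), split according to $\Omega=\Omega_1\cup\Omega_2$, one has $H^1_n\to[H]^1$ and $H^2_n\to[H]^2$ as $n\to\infty$.
   Context: Sequential D-iteration: with $I$ the identity, $J_i$ the matrix whose only non-zero entry is $(J_i)_{ii}=1$, and $P_i=I-J_i+PJ_i$, one sets $F_0=B$, $H_0=0$, $F_n=P_{i_n}F_{n-1}$, $H_n=H_{n-1}+J_{i_n}F_{n-1}$. Distributed D-iteration: fix a partition $\Omega=\{1,\dots,N\}=\Omega_1\cup\Omega_2$ and decompose accordingly $P=\begin{pmatrix}P_{11}&P_{12}\\P_{21}&P_{22}\end{pmatrix}$, $B=(B_1,B_2)$. Processor PID$_j$ ($j=1,2$) maintains vectors $F^j_n,H^j_n\in\mathbb{R}^{\Omega_j}$ indexed by a common discrete time $n=0,1,2,\dots$, with $F^j_0=B_j$, $H^j_0=0$. For each ordered pair (sender $k$, receiver $j$), $k\ne j$, there are sending times $0=T_0'<T_1'<T_2'<\cdots$ and receiving times $T_n\ge T_n'$ (integers, $n\ge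 1$; these times may be different for the two directions, and messages need not arrive in the order sent). The $n$-th message is $P_{jk}\,(H^k_{T_n'}-H^k_{T_{n-1}'})$ and it is received by PID$_j$ at time $T_n$. Let $G^{k}_m$ be the sum of the messages from PID$_k$ received by PID$_j$ at time $m$ ($0$ if none). At each time step $n\ge1$, PID$_j$ adds the received fluid and then either performs one diffusion at a node $i=i^j_n\in\Omega_j$, namely $$F^j_n=(I-J_i+P_{jj}J_i)(F^j_{n-1}+G^{k}_{n-1}),\qquad H^j_n=H^j_{n-1}+J_i(F^j_{n-1}+G^{k}_{n-1}),$$ or is idle ($F^j_n=F^j_{n-1}+G^k_{n-1}$, $H^j_n=H^j_{n-1}$), so that processors may have different speeds. The sequences of diffused nodes are fixed in advance, independently of the fluid exchanges. PID$_j$ applies a fair sequence if every node of $\Omega_j$ is diffused infinitely often. *)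

theory Defs
  imports "HOL-Analysis.Analysis"
begin

definition complex_spectrum :: "real^'n^'n \<Rightarrow> complex set" where
  "complex_spectrum A = {\<mu>. \<exists>v :: complex^'n. v \<noteq> 0 \<and> map_matrix complex_of_real A *v v = \<mu> *s v}"

definition spec_radius :: "real^'n^'n \<Rightarrow> real" where
  "spec_radius A = Max (cmod ` complex_spectrum A)"

definition unit_diag :: "'n \<Rightarrow> real^'n^'n" where
  "unit_diag i = (\<chi> a b. if a = i \<and> b = i then 1 else 0)"

definition diffusion_matrix :: "real^'n^'n \<Rightarrow> 'n \<Rightarrow> real^'n^'n" where
  "diffusion_matrix P i = mat 1 - unit_diag i + P ** unit_diag i"

(* Step n >= 1 diffuses the node s n; the value s 0 is never used, here and below. *)
primrec D_fluid :: "real^'n^'n \<Rightarrow> real^'n \<Rightarrow> (nat \<Rightarrow> 'n) \<Rightarrow> nat \<Rightarrow> real^'n" where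
  "D_fluid P B s 0 = B"
| "D_fluid P B s (Suc n) = diffusion_matrix P (s (Suc n)) *v D_fluid P B s n"

primrec D_history :: "real^'n^'n \<Rightarrow> real^'n \<Rightarrow> (nat \<Rightarrow> 'n) \<Rightarrow> nat \<Rightarrow> real^'n" where
  "D_history P B s 0 = 0"
| "D_history P B s (Suc n) = D_history P B s n + unit_diag (s (Suc n)) *v D_fluid P B s n"

definition fair_seq :: "(nat \<Rightarrow> 'n) \<Rightarrow> bool" where
  "fair_seq s \<longleftrightarrow> (\<forall>i. \<exists>\<^sub>\<infinity>n. s n = i)"

(* A vector indexed by a block of nodes is represented by its extension by zero to all
   nodes, and a block of a matrix likewise. *)
definition vec_part :: "'n set \<Rightarrow> real^'n \<Rightarrow> real^'n" where
  "vec_part S v = (\<chi> a. if a \<in> S then v $ a else 0)"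

definition mat_block :: "'n set \<Rightarrow> 'n set \<Rightarrow> real^'n^'n \<Rightarrow> real^'n^'n" where
  "mat_block S R P = (\<chi> a b. if a \<in> S \<and> b \<in> R then P $ a $ b else 0)"

datatype pid = PID1 | PID2

primrec peer :: "pid \<Rightarrow> pid" where
  "peer PID1 = PID2"
| "peer PID2 = PID1"

(* The value None stands for an idle step. *)
definition local_schedule :: "'n set \<Rightarrow> (nat \<Rightarrow> 'n option) \<Rightarrow> bool" where
  "local_schedule S s \<longleftrightarrow> (\<forall>n\<ge>1. \<forall>i. s n = Some i \<longrightarrow> i \<in> S)"

definition fair_on :: "'n set \<Rightarrow> (nat \<Rightarrow> 'n option) \<Rightarrow> bool" where
  "fair_on S s \<longleftrightarrow> (\<forall>i\<in>S. \<exists>\<^sub>\<infinity>n. s n = Some i)"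

definition transmission_times :: "(nat \<Rightarrow> nat) \<Rightarrow> (nat \<Rightarrow> nat) \<Rightarrow> bool" where
  "transmission_times Ts Tr \<longleftrightarrow> Ts 0 = 0 \<and> strict_mono Ts \<and> (\<forall>n\<ge>1. Ts n \<le> Tr n)"

(* If transmission_times Ts Tr, then n <= Ts n <= Tr n for n >= 1, so the index set of the
   sum is finite, and for time m only values Hk t with t <= m occur. *)
definition received_fluid ::
  "real^'n^'n \<Rightarrow> (nat \<Rightarrow> real^'n) \<Rightarrow> (nat \<Rightarrow> nat) \<Rightarrow> (nat \<Rightarrow> nat) \<Rightarrow> nat \<Rightarrow> real^'n" where
  "received_fluid Q Hk Ts Tr m =
     (\<Sum>n | 1 \<le> n \<and> Tr n = m. Q *v (Hk (Ts n) - Hk (Ts (n - 1))))"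

(* Ts j and Tr j are the sending and receiving times of the messages from peer j to j.
   The right-hand sides at time Suc n only involve F and H at times up to n, so these
   equations determine F and H. *)
definition distributed_D_iteration ::
  "real^'n^'n \<Rightarrow> real^'n \<Rightarrow> (pid \<Rightarrow> 'n set) \<Rightarrow> (pid \<Rightarrow> nat \<Rightarrow> 'n option) \<Rightarrow>
   (pid \<Rightarrow> nat \<Rightarrow> nat) \<Rightarrow> (pid \<Rightarrow> nat \<Rightarrow> nat) \<Rightarrow>
   (pid \<Rightarrow> nat \<Rightarrow> real^'n) \<Rightarrow> (pid \<Rightarrow> nat \<Rightarrow> real^'n) \<Rightarrow> bool" where
  "distributed_D_iteration P B \<Omega> s Ts Tr F H \<longleftrightarrow>
     (\<forall>j. F j 0 = vec_part (\<Omega> j) B \<and> H j 0 = 0 \<and>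
       (\<forall>n. let X = F j n + received_fluid (mat_block (\<Omega> j) (\<Omega> (peer j)) P)
                               (H (peer j)) (Ts j) (Tr j) n
             in case s j (Suc n) of
                  None \<Rightarrow> F j (Suc n) = X \<and> H j (Suc n) = H j n
                | Some i \<Rightarrow>
                    F j (Suc n) = diffusion_matrix (mat_block (\<Omega> j) (\<Omega> j) P) i *v X \<and>
                    H j (Suc n) = H j n + unit_diag i *v X))"

end

theory Submission
  imports Defs "HOL-Computational_Algebra.Polynomial"
begin

text \<open>The history vectors converge because they have bounded variation, and fairness then forces
the limit to solve \<open>H = B + PH\<close>.

Bounded variation needs some care: \<open>B\<close> may have entries of both signs, and messages may overtake each other, so
that the peer's fluid seen by a processor need not come from any earlier state of the peer. Let \<open>V\<close> be the
entrywise total variation of the history of a processor. Tracking absolute values through one step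
shows that \<open>\<bar>F\<bar> + V\<close> is at most \<open>\<bar>B\<bar>\<close> plus \<open>P\<close> applied to the variation of the processor itself and to the sum of
the absolute increments that it has received (\<open>variation_dominated\<close>). The latter sum is at most the variation of the
peer, regardless of the order of arrival. Now \<open>\<rho>(P) < 1\<close> provides a vector \<open>x \<ge> 0\<close> with \<open>x = (1, \<dots>, 1) + P x\<close>
(\<open>exists_nonneg_solution_for_ones\<close>), and if \<open>\<bar>B\<bar> \<le> c\<close> then \<open>V \<le> c x\<close> is preserved by every step, since
\<open>c + P (c x) = c x\<close> (\<open>variation_bounded\<close>).

Hence both histories converge, and the messages form an absolutely convergent series, so the sum of those
received so far tends to the limit of the peer's history (\<open>received_increments_tendsto\<close>). Whenever node \<open>i\<close> is
diffused, conservation of fluid says that the new history at \<open>i\<close> equals \<open>B\<close> plus \<open>P\<close> applied to the own history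
and to the sum of received increments, at \<open>i\<close>. Passing to the limit along the infinitely many diffusions
of \<open>i\<close> gives the fixed-point equation (\<open>limit_component\<close>), whose only solution is \<open>(I - P)\<^sup>-\<^sup>1 B\<close>.

The sequential iteration is the special case in which one processor owns all nodes
(\<open>D_iteration_as_distributed\<close>).\<close>

section \<open>Matrices of spectral radius less than one\<close>

lemma det_eq_0_if_kernel:
  fixes A :: "'a::field^'n^'n"
  assumes "A *v v = 0" and "v \<noteq> 0"
  shows "det A = 0"
proof (rule ccontr)
  assume "det A \<noteq> 0"
  then have "\<exists>B. B ** A = mat 1"
    by (meson invertible_det_nz invertible_def)
  then show False
    using assms matrix_left_invertible_ker by blast
qed

text \<open>Finiteness is what makes the maximum in \<^const>\<open>spec_radius\<close> an actual
upper bound. The determinant of \<open>I - tP\<close> is a polynomial in \<open>t\<close> with value \<open>1\<close> at \<open>0\<close>, so it has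
finitely many roots, and the inverse of every non-zero eigenvalue is one of them.\<close>

lemma finite_complex_spectrum: "finite (complex_spectrum (P :: real^'n^'n))"
proof -
  define A where "A = map_matrix complex_of_real P"
  \<comment> \<open>\<open>M\<close> is \<open>I - tA\<close> over the ring of polynomials in \<open>t\<close>, where its determinant makes sense as well.\<close>
  define M :: "complex poly^'n^'n" where "M = (\<chi> i j. [:if i = j then 1 else 0, - (A $ i $ j):])"
  define D where "D t = (\<chi> i j. poly (M $ i $ j) t)" for t
  have poly_det: "poly (det M) t = det (D t)" for t
    by (simp add: det_def D_def poly_sum poly_prod)
  have "D 0 = mat 1"
    by (simp add: D_def M_def mat_def vec_eq_iff)
  then have "poly (det M) 0 = 1"
    by (simp add: poly_det)
  then have "finite {t. poly (det M) t = 0}"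
    by (intro poly_roots_finite) auto
  moreover have "\<mu> \<in> insert 0 (inverse ` {t. poly (det M) t = 0})"
    if mu: "\<mu> \<in> complex_spectrum P" for \<mu>
  proof (cases "\<mu> = 0")
    case False
    obtain v where v: "v \<noteq> 0" "A *v v = \<mu> *s v"
      using mu unfolding complex_spectrum_def A_def by blast
    have "(\<Sum>j\<in>UNIV. A $ i $ j * v $ j) = \<mu> * v $ i" for i
      using v(2) by (simp add: vec_eq_iff matrix_vector_mult_def)
    then have "(\<Sum>j\<in>UNIV. poly (M $ i $ j) (inverse \<mu>) * v $ j) = 0" for i
      using False
      by (simp add: M_def left_diff_distrib mult.assoc if_distrib[of "\<lambda>x. x * _"] sum_subtractf sum_distrib_left[symmetric] cong: if_cong)
    then have "D (inverse \<mu>) *v v = 0"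
      by (simp add: vec_eq_iff matrix_vector_mult_def D_def)
    then have "poly (det M) (inverse \<mu>) = 0"
      using v(1) by (simp add: poly_det det_eq_0_if_kernel)
    then show ?thesis
      by (metis (mono_tags, lifting) imageI inverse_inverse_eq insertI2 mem_Collect_eq)
  qed simp
  ultimately show ?thesis
    by (meson finite_imageI finite_insert finite_subset subsetI)
qed

text \<open>A real kernel vector of \<open>I - tP\<close> is an eigenvector of \<open>P\<close> for \<open>1/t \<ge> 1\<close>.\<close>

lemma det_resolvent_nonzero:
  fixes P :: "real^'n^'n"
  assumes "spec_radius P < 1" and t: "0 \<le> t" "t \<le> 1"
  shows "det (mat 1 - t *\<^sub>R P) \<noteq> 0"
proof
  assume "det (mat 1 - t *\<^sub>R P) = 0"
  then have "\<not> (\<exists>B. B ** (mat 1 - t *\<^sub>R P) = mat 1)"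
    by (metis invertible_det_nz invertible_left_inverse)
  then obtain v where v: "(mat 1 - t *\<^sub>R P) *v v = 0" "v \<noteq> 0"
    using matrix_left_invertible_ker by blast
  have "v - t *\<^sub>R (P *v v) = 0"
    using v(1) by (simp add: matrix_vector_mult_diff_rdistrib scaleR_matrix_vector_assoc[symmetric])
  then have fixpoint: "v = t *\<^sub>R (P *v v)"
    by simp
  then have "t \<noteq> 0"
    using v(2) by (metis scaleR_zero_left)
  have eig: "v $ a = t * (\<Sum>b\<in>UNIV. P $ a $ b * v $ b)" for a
    using arg_cong[OF fixpoint, of "\<lambda>v. v $ a"] by (simp only: matrix_vector_mult_def) simp
  define w :: "complex^'n" where "w = (\<chi> a. of_real (v $ a))"
  have "(\<Sum>b\<in>UNIV. complex_of_real (P $ a $ b) * of_real (v $ b)) = of_real (1 / t) * of_real (v $ a)" for a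
  proof -
    have "(\<Sum>b\<in>UNIV. P $ a $ b * v $ b) = 1 / t * v $ a"
      using eig[of a] \<open>t \<noteq> 0\<close> by simp
    then have "complex_of_real (\<Sum>b\<in>UNIV. P $ a $ b * v $ b) = of_real (1 / t * v $ a)"
      by (rule arg_cong)
    then show ?thesis
      by (simp only: of_real_sum of_real_mult)
  qed
  then have "map_matrix complex_of_real P *v w = of_real (1 / t) *s w"
    by (simp add: vec_eq_iff matrix_vector_mult_def w_def)
  moreover have "w \<noteq> 0"
    using v(2) by (auto simp: w_def vec_eq_iff)
  ultimately have "complex_of_real (1 / t) \<in> complex_spectrum P"
    unfolding complex_spectrum_def by blast
  then have "cmod (of_real (1 / t)) \<le> spec_radius P"
    unfolding spec_radius_def by (intro Max_ge) (auto simp: finite_complex_spectrum)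
  moreover have "cmod (of_real (1 / t)) \<ge> 1"
    using t \<open>t \<noteq> 0\<close> by (simp add: norm_divide)
  ultimately show False
    using assms(1) by linarith
qed

lemma continuous_on_det:
  fixes M :: "'a::topological_space \<Rightarrow> real^'n^'n"
  assumes "\<And>i j. continuous_on S (\<lambda>t. M t $ i $ j)"
  shows "continuous_on S (\<lambda>t. det (M t))"
  unfolding det_def by (intro continuous_intros assms)

text \<open>This is where \<open>P \<ge> 0\<close> and \<open>\<rho>(P) < 1\<close> meet: \<open>(I - P)\<^sup>-\<^sup>1\<close> preserves the sign of \<open>(1, \<dots>, 1)\<close>. Let \<open>x(t)\<close>
solve \<open>x(t) = (1, \<dots>, 1) + t P x(t)\<close> for \<open>0 \<le> t \<le> 1\<close>; by Cramer's rule it is continuous in \<open>t\<close>. If \<open>x(t) \<ge> 0\<close>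
then the equation improves this to \<open>x(t) \<ge> 1\<close>, so the set of \<open>t\<close> with \<open>x(t) \<ge> 0\<close> is both closed and open in
the unit interval. It contains \<open>0\<close>, hence also \<open>1\<close>.\<close>

lemma exists_nonneg_solution_for_ones:
  fixes P :: "real^'n^'n"
  assumes nonneg: "\<And>a b. 0 \<le> P $ a $ b" and "spec_radius P < 1"
  obtains x where "\<And>a. 0 \<le> x $ a" and "x = vec 1 + P *v x"
proof -
  define A where "A t = mat 1 - t *\<^sub>R P" for t :: real
  define x :: "real \<Rightarrow> real^'n" where
    "x t = (\<chi> k. det (\<chi> i j. if j = k then 1 else A t $ i $ j) / det (A t))" for t
  let ?I = "{0..1::real}"
  have det_A: "det (A t) \<noteq> 0" if "t \<in> ?I" for t
    using that det_resolvent_nonzero[OF assms(2)] by (auto simp: A_def)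
  have "A t *v x t = vec 1" if "t \<in> ?I" for t
    using det_A[OF that] by (subst cramer) (auto simp: x_def vec_eq_iff cong: if_cong)
  then have fixpoint: "x t = vec 1 + t *\<^sub>R (P *v x t)" if "t \<in> ?I" for t
    using that unfolding A_def
    by (simp add: matrix_vector_mult_diff_rdistrib scaleR_matrix_vector_assoc[symmetric] diff_eq_eq)
  have cont_A: "continuous_on ?I (\<lambda>t. A t $ i $ j)" for i j
    unfolding A_def by (auto intro!: continuous_intros)
  have "continuous_on ?I (\<lambda>t. det (\<chi> i j. if j = k then 1 else A t $ i $ j))" for k
  proof (rule continuous_on_det)
    show "continuous_on ?I (\<lambda>t. (\<chi> i j. if j = k then 1 else A t $ i $ j) $ i $ j)" for i j
      by (cases "j = k") (simp_all add: cont_A cong: if_cong)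
  qed
  moreover have "continuous_on ?I (\<lambda>t. det (A t))"
    by (intro continuous_on_det cont_A)
  ultimately have "continuous_on ?I x"
    unfolding x_def using det_A by (intro continuous_intros) auto
  moreover have "closed {v::real^'n. \<forall>a. 0 \<le> v $ a}"
    by (intro closed_Collect_all closed_Collect_le continuous_intros)
  moreover have "open {v::real^'n. \<forall>a. 0 < v $ a}"
    by (auto simp: Collect_all_eq intro!: open_INT open_Collect_less continuous_intros)
  ultimately have clopen: "closedin (top_of_set ?I) (?I \<inter> x -` {v. \<forall>a. 0 \<le> v $ a})"
      "openin (top_of_set ?I) (?I \<inter> x -` {v. \<forall>a. 0 < v $ a})"
    using continuous_closedin_preimage continuous_openin_preimage_gen by blast+
  have "0 < x t $ a" if "t \<in> ?I" and "\<forall>a. 0 \<le> x t $ a" for t a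
  proof -
    have "0 \<le> (P *v x t) $ a"
      using that nonneg by (simp add: matrix_vector_mult_def sum_nonneg)
    then have "1 \<le> (vec 1 + t *\<^sub>R (P *v x t)) $ a"
      using that(1) by simp
    then show ?thesis
      using arg_cong[OF fixpoint[OF that(1)], of "\<lambda>v. v $ a"] by linarith
  qed
  then have "?I \<inter> x -` {v. \<forall>a. 0 < v $ a} = ?I \<inter> x -` {v. \<forall>a. 0 \<le> v $ a}"
    by (auto intro: less_imp_le)
  moreover have "x 0 = vec 1"
    using fixpoint[of 0] by (simp only: scaleR_zero_left) simp
  then have "0 \<in> ?I \<inter> x -` {v. \<forall>a. 0 \<le> v $ a}"
    by simp
  ultimately have "?I \<inter> x -` {v. \<forall>a. 0 \<le> v $ a} = ?I"
    using clopen connected_Icc[of 0 "1::real"] unfolding connected_clopen by (metis empty_iff)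
  then have "\<And>a. 0 \<le> x 1 $ a"
    by fastforce
  moreover have "x 1 = vec 1 + P *v x 1"
    using fixpoint[of 1] by (simp only: scaleR_one) simp
  ultimately show ?thesis
    using that by blast
qed

section \<open>Sequences of bounded variation\<close>

text \<open>The increments between successive sending times live on disjoint time intervals,
so any finite selection of them, received in whatever order, has at most the total variation.\<close>

lemma sum_norm_increments_le_variation:
  fixes h :: "nat \<Rightarrow> 'a::real_normed_vector" and t :: "nat \<Rightarrow> nat"
  assumes "mono t" and "finite M" and "\<And>m. m \<in> M \<Longrightarrow> t m \<le> n"
  shows "(\<Sum>m\<in>M. norm (h (t m) - h (t (m - 1)))) \<le> (\<Sum>k<n. norm (h (Suc k) - h k))"
proof -
  have disj: "disjoint_family_on (\<lambda>m. {t (m - 1)..<t m}) M"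
  proof -
    have "{t (m - 1)..<t m} \<inter> {t (l - 1)..<t l} = {}" if "m < l" for m l
    proof -
      have "t m \<le> t (l - 1)"
        using that by (intro monoD[OF assms(1)]) simp
      then show ?thesis
        by auto
    qed
    then show ?thesis
      unfolding disjoint_family_on_def by (metis inf_commute linorder_neqE_nat)
  qed
  have "(\<Sum>m\<in>M. norm (h (t m) - h (t (m - 1))))
      \<le> (\<Sum>m\<in>M. \<Sum>k\<in>{t (m - 1)..<t m}. norm (h (Suc k) - h k))"
  proof (rule sum_mono)
    fix m
    have "t (m - 1) \<le> t m"
      using assms(1) by (simp add: monoD)
    then have "h (t m) - h (t (m - 1)) = (\<Sum>k\<in>{t (m - 1)..<t m}. h (Suc k) - h k)"
      by (simp add: sum_Suc_diff')
    then show "norm (h (t m) - h (t (m - 1))) \<le> (\<Sum>k\<in>{t (m - 1)..<t m}. norm (h (Suc k) - h k))"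
      by (simp add: norm_sum)
  qed
  also have "\<dots> = (\<Sum>k\<in>(\<Union>m\<in>M. {t (m - 1)..<t m}). norm (h (Suc k) - h k))"
    using disj assms(2) by (subst sum.UNION_disjoint_family) auto
  also have "\<dots> \<le> (\<Sum>k<n. norm (h (Suc k) - h k))"
    using assms(3) by (intro sum_mono2) fastforce+
  finally show ?thesis .
qed

lemma convergent_if_bounded_variation:
  fixes h :: "nat \<Rightarrow> 'a::banach"
  assumes "summable (\<lambda>k. norm (h (Suc k) - h k))"
  shows "convergent h"
proof -
  have "(\<lambda>n. \<Sum>k<n. h (Suc k) - h k) \<longlonglongrightarrow> (\<Sum>k. h (Suc k) - h k)"
    using summable_LIMSEQ summable_norm_cancel[OF assms] by blast
  then have "(\<lambda>n. h 0 + (h n - h 0)) \<longlonglongrightarrow> h 0 + (\<Sum>k. h (Suc k) - h k)"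
    unfolding sum_lessThan_telescope by (intro tendsto_intros)
  then show ?thesis
    by (auto simp: convergent_def)
qed

text \<open>The messages received before time \<open>n\<close> need not form an initial segment of those
sent. Bounded variation makes the series of all messages absolutely convergent, so that its partial
sums may be taken over any sets that eventually contain every index.\<close>

lemma received_increments_tendsto:
  fixes h :: "nat \<Rightarrow> 'a::banach"
  assumes "transmission_times t r"
    and var: "summable (\<lambda>k. norm (h (Suc k) - h k))"
    and lim: "h \<longlonglongrightarrow> L"
  shows "(\<lambda>n. \<Sum>m | 1 \<le> m \<and> r m < n. h (t m) - h (t (m - 1))) \<longlonglongrightarrow> L - h 0"
proof -
  have t: "t 0 = 0" "strict_mono t" and r: "\<And>m. 1 \<le> m \<Longrightarrow> t m \<le> r m"
    using assms(1) by (auto simp: transmission_times_def)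
  define d where "d m = h (t m) - h (t (m - 1))" for m
  define R where "R n = {m. 1 \<le> m \<and> r m < n}" for n
  have "(\<Sum>m<n. norm (d m)) \<le> (\<Sum>k. norm (h (Suc k) - h k))" for n
  proof -
    have "(\<Sum>m<n. norm (d m)) \<le> (\<Sum>k<t n. norm (h (Suc k) - h k))"
      unfolding d_def using t(2)
      by (intro sum_norm_increments_le_variation)
        (auto simp: strict_mono_mono strict_mono_less_eq)
    also have "\<dots> \<le> (\<Sum>k. norm (h (Suc k) - h k))"
      by (intro sum_le_suminf var) auto
    finally show ?thesis .
  qed
  then have abs_summable: "summable (\<lambda>m. norm (d m))"
    by (intro summableI_nonneg_bounded) auto
  have "(\<Sum>m<Suc n. d m) = h (t n) - h 0" for n
    by (induction n) (simp_all add: d_def t(1))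
  moreover have "(\<lambda>n. h (t n)) \<longlonglongrightarrow> L"
    using LIMSEQ_subseq_LIMSEQ[OF lim t(2)] by (simp add: o_def)
  ultimately have "(\<lambda>n. \<Sum>m<Suc n. d m) \<longlonglongrightarrow> L - h 0"
    by (auto intro!: tendsto_intros)
  then have "d sums (L - h 0)"
    unfolding sums_def by (rule LIMSEQ_imp_Suc)
  then have "(d has_sum (L - h 0)) UNIV"
    using abs_summable norm_summable_imp_has_sum by blast
  then have unordered: "(sum d \<longlongrightarrow> L - h 0) (finite_subsets_at_top UNIV)"
    by (simp add: has_sum_def)
  have d0: "d 0 = 0"
    by (simp add: d_def)
  have fin: "finite (R n)" for n
  proof (rule finite_subset)
    show "R n \<subseteq> {..n}"
      using r strict_mono_imp_increasing[OF t(2)] by (force simp: R_def intro: le_trans)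
  qed simp
  \<comment> \<open>There is no message \<open>0\<close>, but \<open>0 - 1 = 0\<close> on naturals gives \<open>d 0 = 0\<close>, so that index is harmless.\<close>
  have "filterlim (\<lambda>n. insert 0 (R n)) (finite_subsets_at_top UNIV) sequentially"
    unfolding filterlim_finite_subsets_at_top
  proof (intro allI impI)
    fix X :: "nat set"
    assume "finite X \<and> X \<subseteq> UNIV"
    then have X: "finite X" by simp
    have "\<forall>\<^sub>F n in sequentially. \<forall>m\<in>X. r m < n"
      using X by (intro eventually_ball_finite) (auto intro: eventually_gt_at_top)
    then show "\<forall>\<^sub>F n in sequentially. finite (insert 0 (R n)) \<and> X \<subseteq> insert 0 (R n) \<and> insert 0 (R n) \<subseteq> UNIV"
      by eventually_elim (use fin in \<open>auto simp: R_def Suc_le_eq\<close>)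
  qed
  then have "(\<lambda>n. sum d (insert 0 (R n))) \<longlonglongrightarrow> L - h 0"
    using filterlim_compose[OF unordered] by blast
  moreover have "sum d (insert 0 (R n)) = sum d (R n)" for n
    using fin d0 by (simp add: sum.insert_if)
  ultimately show ?thesis
    by (simp add: R_def d_def)
qed

section \<open>Non-negative matrices, diffusions and blocks\<close>

lemma mult_mono_nonneg_matrix:
  fixes Q :: "real^'m^'n"
  assumes "\<And>a b. 0 \<le> Q $ a $ b" and "\<And>b. u $ b \<le> v $ b"
  shows "(Q *v u) $ a \<le> (Q *v v) $ a"
  using assms by (auto simp: matrix_vector_mult_def intro!: sum_mono mult_left_mono)

lemma abs_mult_le_nonneg_matrix:
  fixes Q :: "real^'m^'n"
  assumes "\<And>a b. 0 \<le> Q $ a $ b"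
  shows "\<bar>(Q *v v) $ a\<bar> \<le> (Q *v \<bar>v\<bar>) $ a"
proof -
  have "\<bar>\<Sum>b\<in>UNIV. Q $ a $ b * v $ b\<bar> \<le> (\<Sum>b\<in>UNIV. \<bar>Q $ a $ b * v $ b\<bar>)"
    by (rule sum_abs)
  then show ?thesis
    using assms by (simp add: matrix_vector_mult_def abs_vec_def abs_mult)
qed

lemma unit_diag_mult_component: "(unit_diag i *v v) $ a = (if a = i then v $ i else 0)"
  by (auto simp: unit_diag_def matrix_vector_mult_def if_distrib[of "\<lambda>x. x * _"] cong: if_cong)

text \<open>A diffusion removes the fluid at node \<open>i\<close> and redistributes it through \<open>Q\<close>.\<close>

lemma diffusion_matrix_mult:
  "diffusion_matrix Q i *v v = v - unit_diag i *v v + Q *v (unit_diag i *v v)"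
  by (simp add: diffusion_matrix_def matrix_vector_mult_diff_rdistrib
      matrix_vector_mult_add_rdistrib matrix_vector_mul_assoc)

lemma mat_block_mult_component:
  "(mat_block S R P *v v) $ a = (if a \<in> S then \<Sum>b\<in>R. P $ a $ b * v $ b else 0)"
proof -
  have "(\<Sum>b\<in>UNIV. (if b \<in> R then P $ a $ b else 0) * v $ b) = (\<Sum>b\<in>R. P $ a $ b * v $ b)"
    by (rule sum.mono_neutral_cong_right) auto
  then show ?thesis
    by (simp add: mat_block_def matrix_vector_mult_def)
qed

lemma matrix_inv_mult_cancel:
  fixes A :: "'a::field^'n^'n"
  assumes "invertible A" and "A *v x = y"
  shows "matrix_inv A *v y = x"
proof -
  have "matrix_inv A ** A = mat 1"
    using assms(1) someI_ex[of "\<lambda>A'. A ** A' = mat 1 \<and> A' ** A = mat 1"]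
    unfolding invertible_def matrix_inv_def by blast
  then show ?thesis
    using assms(2) by (metis matrix_vector_mul_assoc matrix_vector_mul_lid)
qed

section \<open>Two processors exchanging fluid\<close>

locale distributed_iteration =
  fixes P :: "real^'n^'n" and B :: "real^'n"
    and \<Omega> :: "pid \<Rightarrow> 'n set" and s :: "pid \<Rightarrow> nat \<Rightarrow> 'n option"
    and Ts Tr :: "pid \<Rightarrow> nat \<Rightarrow> nat" and F H :: "pid \<Rightarrow> nat \<Rightarrow> real^'n"
  assumes nonneg: "0 \<le> P $ a $ b"
    and radius: "spec_radius P < 1"
    and cover: "\<Omega> PID1 \<union> \<Omega> PID2 = UNIV" and disjoint: "\<Omega> PID1 \<inter> \<Omega> PID2 = {}"
    and schedule: "local_schedule (\<Omega> j) (s j)"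
    and fair: "fair_on (\<Omega> j) (s j)"
    and times: "transmission_times (Ts j) (Tr j)"
    and iteration: "distributed_D_iteration P B \<Omega> s Ts Tr F H"
begin

lemma partition: "\<Omega> j \<union> \<Omega> (peer j) = UNIV" "\<Omega> j \<inter> \<Omega> (peer j) = {}"
  using cover disjoint by (cases j; auto)+

abbreviation "Q_own j \<equiv> mat_block (\<Omega> j) (\<Omega> j) P"
abbreviation "Q_peer j \<equiv> mat_block (\<Omega> j) (\<Omega> (peer j)) P"

lemma blocks_nonneg: "0 \<le> Q_own j $ a $ b" "0 \<le> Q_peer j $ a $ b"
  by (simp_all add: mat_block_def nonneg)

lemma blocks_mult:
  assumes "a \<in> \<Omega> j"
  shows "(Q_own j *v v) $ a + (Q_peer j *v v) $ a = (P *v v) $ a"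
proof -
  have "(\<Sum>b\<in>UNIV. P $ a $ b * v $ b)
      = (\<Sum>b\<in>\<Omega> j. P $ a $ b * v $ b) + (\<Sum>b\<in>\<Omega> (peer j). P $ a $ b * v $ b)"
    using partition[of j] by (subst sum.union_disjoint[symmetric]) auto
  then show ?thesis
    using assms by (simp add: mat_block_mult_component) (simp add: matrix_vector_mult_def)
qed

definition total_received :: "pid \<Rightarrow> nat \<Rightarrow> real^'n" where
  "total_received j n =
     (\<Sum>m | 1 \<le> m \<and> Tr j m < n. H (peer j) (Ts j m) - H (peer j) (Ts j (m - 1)))"

definition abs_received :: "pid \<Rightarrow> nat \<Rightarrow> real^'n" where
  "abs_received j n =
     (\<Sum>m | 1 \<le> m \<and> Tr j m < n. \<bar>H (peer j) (Ts j m) - H (peer j) (Ts j (m - 1))\<bar>)"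

definition variation :: "pid \<Rightarrow> nat \<Rightarrow> real^'n" where
  "variation j n = (\<Sum>k<n. \<bar>H j (Suc k) - H j k\<bar>)"

text \<open>The content of the processor when it diffuses, with the fluid just received.\<close>

definition fluid :: "pid \<Rightarrow> nat \<Rightarrow> real^'n" where
  "fluid j n = F j n + received_fluid (Q_peer j) (H (peer j)) (Ts j) (Tr j) n"

lemma index_le_receiving_time: "1 \<le> m \<Longrightarrow> m \<le> Tr j m"
  and sending_le_receiving_time: "1 \<le> m \<Longrightarrow> Ts j m \<le> Tr j m"
  and sending_times: "strict_mono (Ts j)"
  using times[of j] strict_mono_imp_increasing[of "Ts j"]
  by (auto simp: transmission_times_def intro: le_trans)

lemma finite_received: "finite {m. 1 \<le> m \<and> Tr j m < n}" "finite {m. 1 \<le> m \<and> Tr j m = n}"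
  by (rule finite_subset[of _ "{..n}"]; use index_le_receiving_time[of _ j] in force)+

lemma received_Suc: "{m. 1 \<le> m \<and> Tr j m < Suc n}
    = {m. 1 \<le> m \<and> Tr j m < n} \<union> {m. 1 \<le> m \<and> Tr j m = n}"
  by auto

lemma total_received_Suc:
  "total_received j (Suc n) - total_received j n
     = (\<Sum>m | 1 \<le> m \<and> Tr j m = n. H (peer j) (Ts j m) - H (peer j) (Ts j (m - 1)))"
  unfolding total_received_def received_Suc using finite_received
  by (subst sum.union_disjoint) auto

lemma abs_received_Suc:
  "abs_received j (Suc n) - abs_received j n
     = (\<Sum>m | 1 \<le> m \<and> Tr j m = n. \<bar>H (peer j) (Ts j m) - H (peer j) (Ts j (m - 1))\<bar>)"
  unfolding abs_received_def received_Suc using finite_received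
  by (subst sum.union_disjoint) auto

lemma received_fluid_eq:
  "received_fluid (Q_peer j) (H (peer j)) (Ts j) (Tr j) n
     = Q_peer j *v (total_received j (Suc n) - total_received j n)"
  by (simp add: total_received_Suc received_fluid_def linear_sum[OF matrix_vector_mul_linear])

lemma abs_received_increment:
  "\<bar>(total_received j (Suc n) - total_received j n) $ b\<bar>
     \<le> (abs_received j (Suc n) - abs_received j n) $ b"
  unfolding total_received_Suc abs_received_Suc
  by (simp only: sum_component) (simp add: abs_vec_def sum_abs)

lemma initial: "F j 0 = vec_part (\<Omega> j) B" "H j 0 = 0"
  using iteration by (simp_all add: distributed_D_iteration_def)

text \<open>Idle steps and diffusions have the same form when they are expressed through the
increment of the history, which vanishes in an idle step.\<close>

lemma step:
  "F j (Suc n) = fluid j n - (H j (Suc n) - H j n) + Q_own j *v (H j (Suc n) - H j n)"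
  "(H j (Suc n) - H j n) $ a = (if s j (Suc n) = Some a then fluid j n $ a else 0)"
proof -
  have "case s j (Suc n) of
      None \<Rightarrow> F j (Suc n) = fluid j n \<and> H j (Suc n) = H j n
    | Some i \<Rightarrow> F j (Suc n) = diffusion_matrix (Q_own j) i *v fluid j n \<and>
        H j (Suc n) = H j n + unit_diag i *v fluid j n"
    using iteration unfolding distributed_D_iteration_def fluid_def Let_def by blast
  then show "F j (Suc n) = fluid j n - (H j (Suc n) - H j n) + Q_own j *v (H j (Suc n) - H j n)"
    and "(H j (Suc n) - H j n) $ a = (if s j (Suc n) = Some a then fluid j n $ a else 0)"
    by (auto simp: diffusion_matrix_mult unit_diag_mult_component split: option.splits)
qed

lemma history_outside: "a \<notin> \<Omega> j \<Longrightarrow> H j n $ a = 0"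
proof (induction n)
  case (Suc n)
  then have "s j (Suc n) \<noteq> Some a"
    using schedule[of j] by (auto simp: local_schedule_def)
  then show ?case
    using step(2)[of j n a] Suc by simp
qed (simp add: initial)

lemma fluid_eq:
  "fluid j n = F j n + (Q_peer j *v total_received j (Suc n) - Q_peer j *v total_received j n)"
  by (simp add: fluid_def received_fluid_eq matrix_vector_mult_diff_distrib)

text \<open>Conservation of fluid: whatever a node has emitted or still holds was there initially
or has arrived through the edges of \<open>P\<close>.\<close>

lemma conservation:
  "F j n + H j n = vec_part (\<Omega> j) B + Q_own j *v H j n + Q_peer j *v total_received j n"
proof (induction n)
  case 0
  then show ?case
    by (simp add: initial total_received_def)
next
  case (Suc n)
  have "F j (Suc n) + H j (Suc n) = (F j n + H j n)
      + (Q_peer j *v total_received j (Suc n) - Q_peer j *v total_received j n)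
      + (Q_own j *v H j (Suc n) - Q_own j *v H j n)"
    by (simp add: step(1) fluid_eq matrix_vector_mult_diff_distrib)
  then show ?case
    unfolding Suc.IH by simp
qed

text \<open>At a node that is being diffused, the left-hand side is the next value of the history,
so this is the fixed-point equation of \<open>H = B + PH\<close> up to delays.\<close>

lemma conservation_fluid:
  "fluid j n + H j n
     = vec_part (\<Omega> j) B + Q_own j *v H j n + Q_peer j *v total_received j (Suc n)"
proof -
  have "fluid j n + H j n = (F j n + H j n)
      + (Q_peer j *v total_received j (Suc n) - Q_peer j *v total_received j n)"
    by (simp add: fluid_eq)
  then show ?thesis
    unfolding conservation by simp
qed

lemma abs_fluid_le:
  "\<bar>fluid j n $ a\<bar> \<le> \<bar>F j n $ a\<bar>
     + (Q_peer j *v abs_received j (Suc n)) $ a - (Q_peer j *v abs_received j n) $ a"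
proof -
  let ?d = "total_received j (Suc n) - total_received j n"
  have "\<bar>(Q_peer j *v ?d) $ a\<bar> \<le> (Q_peer j *v \<bar>?d\<bar>) $ a"
    by (intro abs_mult_le_nonneg_matrix blocks_nonneg)
  also have "\<dots> \<le> (Q_peer j *v (abs_received j (Suc n) - abs_received j n)) $ a"
    using abs_received_increment[of j n] by (intro mult_mono_nonneg_matrix blocks_nonneg) (simp add: abs_vec_def)
  finally show ?thesis
    by (simp add: fluid_def received_fluid_eq matrix_vector_mult_diff_distrib)
qed

text \<open>The analogue of conservation with absolute values, an inequality because fluids of
opposite sign may cancel. A diffusion moves \<open>\<bar>fluid\<bar>\<close> at its node from the first to the second summand on
the left and adds to the first one at most what the second summand on the right gains; an arriving message
adds to the first summand at most what the third one on the right gains.\<close>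

lemma variation_dominated:
  "\<bar>F j n $ a\<bar> + variation j n $ a
     \<le> \<bar>vec_part (\<Omega> j) B $ a\<bar> + (Q_own j *v variation j n) $ a + (Q_peer j *v abs_received j n) $ a"
proof (induction n)
  case 0
  then show ?case
    by (simp add: initial variation_def abs_received_def)
next
  case (Suc n)
  let ?D = "H j (Suc n) - H j n"
  have "\<bar>F j (Suc n) $ a\<bar> \<le> \<bar>(fluid j n - ?D) $ a\<bar> + \<bar>(Q_own j *v ?D) $ a\<bar>"
    by (simp add: step(1) abs_triangle_ineq del: vector_minus_component)
  moreover have "\<bar>(fluid j n - ?D) $ a\<bar> + \<bar>?D $ a\<bar> = \<bar>fluid j n $ a\<bar>"
    by (simp only: vector_minus_component[of "fluid j n"] step(2)) simp
  moreover have "\<bar>(Q_own j *v ?D) $ a\<bar> \<le> (Q_own j *v \<bar>?D\<bar>) $ a"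
    by (intro abs_mult_le_nonneg_matrix blocks_nonneg)
  moreover have "variation j (Suc n) = variation j n + \<bar>?D\<bar>"
    by (simp add: variation_def)
  moreover have "\<bar>?D\<bar> $ a = \<bar>?D $ a\<bar>"
    by (simp add: abs_vec_def)
  ultimately show ?case
    using Suc.IH abs_fluid_le[of j n a]
    by (simp add: matrix_vector_right_distrib del: vector_minus_component)
qed

lemma abs_received_le_variation: "abs_received j (Suc n) $ b \<le> variation (peer j) n $ b"
proof -
  have "Ts j m \<le> n" if "m \<in> {m. 1 \<le> m \<and> Tr j m < Suc n}" for m
    using that sending_le_receiving_time[of m j] by auto
  then show ?thesis
    using sum_norm_increments_le_variation[where h = "\<lambda>k. H (peer j) k $ b",
        OF strict_mono_mono[OF sending_times[of j]] finite_received(1)[of j "Suc n"], of n]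
    by (simp add: abs_received_def variation_def abs_vec_def)
qed

text \<open>Since the received messages are bounded by the variation of the sender, the dominating
inequality bounds the new variation at a diffused node by \<open>\<bar>B\<bar>\<close> plus \<open>P\<close> applied to the earlier variations. Since
\<open>c x = c (1, \<dots>, 1) + P (c x)\<close>, the bound \<open>c x\<close> passes from one time to the next.\<close>

lemma variation_bounded:
  assumes x: "\<And>a. 0 \<le> x $ a" "x = vec 1 + P *v x" and c: "\<And>a. \<bar>B $ a\<bar> \<le> c"
  shows "variation j n $ a \<le> c * x $ a"
proof (induction n arbitrary: j a)
  case 0
  have "0 \<le> c"
    using c[of a] by linarith
  then show ?case
    using x(1) by (simp add: variation_def)
next
  case (Suc n)
  let ?D = "H j (Suc n) - H j n"
  have eq: "variation j (Suc n) $ a = variation j n $ a + \<bar>?D $ a\<bar>"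
    by (simp add: variation_def abs_vec_def)
  show ?case
  proof (cases "s j (Suc n) = Some a")
    case True
    then have a: "a \<in> \<Omega> j"
      using schedule[of j] by (auto simp: local_schedule_def)
    have "(Q_own j *v variation j n) $ a \<le> (Q_own j *v (c *\<^sub>R x)) $ a"
      using Suc.IH by (intro mult_mono_nonneg_matrix blocks_nonneg) simp
    moreover have "(Q_peer j *v abs_received j (Suc n)) $ a \<le> (Q_peer j *v (c *\<^sub>R x)) $ a"
      using order_trans[OF abs_received_le_variation Suc.IH]
      by (intro mult_mono_nonneg_matrix blocks_nonneg) simp
    moreover have "\<bar>vec_part (\<Omega> j) B $ a\<bar> \<le> c"
      using a c by (simp add: vec_part_def)
    moreover have "(Q_own j *v (c *\<^sub>R x)) $ a + (Q_peer j *v (c *\<^sub>R x)) $ a = c * (P *v x) $ a"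
      using blocks_mult[OF a, of "c *\<^sub>R x"] by (simp add: matrix_vector_mult_scaleR)
    moreover have "x $ a = 1 + (P *v x) $ a"
      using arg_cong[OF x(2), of "\<lambda>v. v $ a"] by simp
    then have "c * x $ a = c + c * (P *v x) $ a"
      by (simp add: distrib_left)
    moreover have "?D $ a = fluid j n $ a"
      using True step(2)[of j n a] by simp
    ultimately show ?thesis
      using eq variation_dominated[of j n a] abs_fluid_le[of j n a] by linarith
  next
    case False
    then show ?thesis
      using eq step(2)[of j n a] Suc.IH[of j a] by simp
  qed
qed

lemma summable_increments: "summable (\<lambda>k. norm (H j (Suc k) - H j k))"
proof -
  obtain x where x: "\<And>a. 0 \<le> x $ a" "x = vec 1 + P *v x"
    using exists_nonneg_solution_for_ones[OF nonneg radius] by blast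
  have "\<bar>B $ a\<bar> \<le> norm B" for a
    by (rule component_le_norm_cart)
  note bound = variation_bounded[OF x this]
  have "(\<Sum>k<n. norm (H j (Suc k) - H j k)) \<le> (\<Sum>a\<in>UNIV. norm B * x $ a)" for n
  proof -
    have "(\<Sum>k<n. norm (H j (Suc k) - H j k)) \<le> (\<Sum>k<n. \<Sum>a\<in>UNIV. \<bar>(H j (Suc k) - H j k) $ a\<bar>)"
      by (intro sum_mono norm_le_l1_cart)
    also have "\<dots> = (\<Sum>a\<in>UNIV. variation j n $ a)"
      by (subst sum.swap) (simp add: variation_def abs_vec_def)
    also have "\<dots> \<le> (\<Sum>a\<in>UNIV. norm B * x $ a)"
      by (intro sum_mono bound)
    finally show ?thesis .
  qed
  then show ?thesis
    by (intro summableI_nonneg_bounded) auto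
qed

text \<open>The conservation law turns into the limit equation along the times at which node \<open>i\<close>
is diffused; fairness supplies infinitely many of them.\<close>

lemma limit_component:
  assumes lim: "\<And>j. H j \<longlonglongrightarrow> L j" and i: "i \<in> \<Omega> j"
  shows "L j $ i = B $ i + (Q_own j *v L j) $ i + (Q_peer j *v L (peer j)) $ i"
proof (rule ccontr)
  let ?y = "vec_part (\<Omega> j) B + Q_own j *v L j + Q_peer j *v L (peer j)"
  let ?f = "\<lambda>n. vec_part (\<Omega> j) B + Q_own j *v H j n + Q_peer j *v total_received j (Suc n)"
  assume "L j $ i \<noteq> B $ i + (Q_own j *v L j) $ i + (Q_peer j *v L (peer j)) $ i"
  then have ne: "L j $ i - ?y $ i \<noteq> 0"
    using i by (simp add: vec_part_def)
  have "(\<lambda>n. total_received j n) \<longlonglongrightarrow> L (peer j)"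
    using received_increments_tendsto[OF times[of j] summable_increments[of "peer j"] lim[of "peer j"]]
    unfolding total_received_def initial by simp
  then have "(\<lambda>n. H j (Suc n) $ i - ?f n $ i) \<longlonglongrightarrow> L j $ i - ?y $ i"
    by (intro tendsto_intros LIMSEQ_Suc lim
        bounded_linear.tendsto[OF matrix_vector_mul_bounded_linear])
  then have "\<forall>\<^sub>F n in sequentially. H j (Suc n) $ i - ?f n $ i \<noteq> 0"
    using ne tendsto_imp_eventually_ne by blast
  then obtain N where N: "\<And>n. n \<ge> N \<Longrightarrow> H j (Suc n) $ i \<noteq> ?f n $ i"
    unfolding eventually_sequentially by auto
  obtain n where "n > N" "s j n = Some i"
    using fair[of j] i unfolding fair_on_def INFM_nat by blast
  then obtain k where k: "k \<ge> N" "s j (Suc k) = Some i"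
    by (metis less_Suc_eq_le not_less_zero not0_implies_Suc)
  then have "H j (Suc k) $ i = (fluid j k + H j k) $ i"
    using step(2)[of j k i] by simp
  then show False
    using N[OF k(1)] conservation_fluid[of j k] by metis
qed

theorem history_tendsto:
  "H j \<longlonglongrightarrow> vec_part (\<Omega> j) (matrix_inv (mat 1 - P) *v B)"
proof -
  obtain L where lim: "\<And>j. H j \<longlonglongrightarrow> L j"
    using convergent_if_bounded_variation[OF summable_increments]
    unfolding convergent_def by metis
  have outside: "L j $ a = 0" if "a \<notin> \<Omega> j" for j a
  proof -
    have "(\<lambda>n. H j n $ a) \<longlonglongrightarrow> L j $ a"
      by (intro tendsto_intros lim)
    then show ?thesis
      using history_outside[OF that] by (simp add: LIMSEQ_const_iff)
  qed
  define h where "h = L PID1 + L PID2"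
  have part: "h $ a = L j $ a" if "a \<in> \<Omega> j" for j a
  proof -
    have "L (peer j) $ a = 0"
      using outside that partition(2)[of j] by blast
    then show ?thesis
      by (cases j) (simp_all add: h_def)
  qed
  have "h $ i = (B + P *v h) $ i" for i
  proof -
    obtain j where i: "i \<in> \<Omega> j"
      using cover by blast
    have "(Q_own j *v L j) $ i = (Q_own j *v h) $ i"
      and "(Q_peer j *v L (peer j)) $ i = (Q_peer j *v h) $ i"
      by (simp_all add: mat_block_mult_component part)
    then show ?thesis
      using limit_component[OF lim i] part[OF i] blocks_mult[OF i, of h] by simp
  qed
  then have "h = B + P *v h"
    by (simp add: vec_eq_iff)
  then have "(mat 1 - P) *v h = B"
    by (simp add: matrix_vector_mult_diff_rdistrib diff_eq_eq)
  moreover have "invertible (mat 1 - P)"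
    using det_resolvent_nonzero[OF radius, of 1] by (simp add: invertible_det_nz)
  ultimately have "matrix_inv (mat 1 - P) *v B = h"
    using matrix_inv_mult_cancel by blast
  moreover have "vec_part (\<Omega> j) h = L j"
    using part outside by (auto simp: vec_part_def vec_eq_iff)
  ultimately show ?thesis
    using lim by simp
qed

end

section \<open>The sequential iteration and the limit theorem\<close>

text \<open>A single processor is a distributed system whose second processor owns no node and
is always idle. The messages all vanish, so their times may be anything admissible.\<close>

lemma D_iteration_as_distributed:
  fixes P :: "real^'n^'n" and B :: "real^'n" and \<sigma> :: "nat \<Rightarrow> 'n"
  defines "\<Omega> \<equiv> case_pid UNIV {}"
    and "s \<equiv> case_pid (Some \<circ> \<sigma>) (\<lambda>_. None)"
    and "F \<equiv> case_pid (D_fluid P B \<sigma>) (\<lambda>_. 0)"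
    and "H \<equiv> case_pid (D_history P B \<sigma>) (\<lambda>_. 0)"
  assumes "\<And>a b. 0 \<le> P $ a $ b" and "spec_radius P < 1" and "fair_seq \<sigma>"
  shows "distributed_iteration P B \<Omega> s (\<lambda>_ n. n) (\<lambda>_ n. n) F H"
proof -
  have block: "mat_block UNIV UNIV P = P" and part: "vec_part UNIV B = B" "vec_part {} B = 0"
    by (simp_all add: mat_block_def vec_part_def vec_eq_iff)
  have empty: "mat_block S R P *v v = 0" if "S = {} \<or> R = {}" for S R and v :: "real^'n"
    using that by (auto simp: vec_eq_iff mat_block_mult_component)
  have "fair_on (\<Omega> j) (s j) \<and> local_schedule (\<Omega> j) (s j)" for j
    using assms(7)
    by (cases j) (simp_all add: fair_on_def fair_seq_def local_schedule_def \<Omega>_def s_def)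
  moreover have "distributed_D_iteration P B \<Omega> s (\<lambda>_ n. n) (\<lambda>_ n. n) F H"
    unfolding distributed_D_iteration_def Let_def
  proof (intro allI conjI)
    fix j n
    show "F j 0 = vec_part (\<Omega> j) B" "H j 0 = 0"
      by (cases j; simp add: F_def H_def \<Omega>_def part)+
    have no_messages: "received_fluid (mat_block (\<Omega> j) (\<Omega> (peer j)) P) (H (peer j)) (\<lambda>n. n) (\<lambda>n. n) n = 0"
      by (cases j) (simp_all add: received_fluid_def \<Omega>_def empty)
    show "case s j (Suc n) of
        None \<Rightarrow>
          F j (Suc n) = F j n + received_fluid (mat_block (\<Omega> j) (\<Omega> (peer j)) P) (H (peer j)) (\<lambda>n. n) (\<lambda>n. n) n \<and>
          H j (Suc n) = H j n
      | Some i \<Rightarrow>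
          F j (Suc n) = diffusion_matrix (mat_block (\<Omega> j) (\<Omega> j) P) i *v
            (F j n + received_fluid (mat_block (\<Omega> j) (\<Omega> (peer j)) P) (H (peer j)) (\<lambda>n. n) (\<lambda>n. n) n) \<and>
          H j (Suc n) = H j n + unit_diag i *v
            (F j n + received_fluid (mat_block (\<Omega> j) (\<Omega> (peer j)) P) (H (peer j)) (\<lambda>n. n) (\<lambda>n. n) n)"
      unfolding no_messages
      by (cases j) (simp_all add: F_def H_def s_def \<Omega>_def block)
  qed
  ultimately show ?thesis
    using assms(5,6)
    by unfold_locales (auto simp: \<Omega>_def transmission_times_def strict_mono_def)
qed

lemma D_history_tendsto:
  fixes P :: "real^'n^'n"
  assumes "\<And>a b. 0 \<le> P $ a $ b" and "spec_radius P < 1" and "fair_seq \<sigma>"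
  shows "D_history P B \<sigma> \<longlonglongrightarrow> matrix_inv (mat 1 - P) *v B"
proof -
  have "vec_part UNIV v = v" for v :: "real^'n"
    by (simp add: vec_part_def)
  then show ?thesis
    using distributed_iteration.history_tendsto[OF D_iteration_as_distributed[OF assms, of B], where j = PID1]
    by simp
qed

theorem theorem15:
  fixes P :: "real^'n^'n" and B :: "real^'n"
    and \<Omega> :: "pid \<Rightarrow> 'n set"
    and s :: "pid \<Rightarrow> nat \<Rightarrow> 'n option"
    and Ts Tr :: "pid \<Rightarrow> nat \<Rightarrow> nat"
    and F H :: "pid \<Rightarrow> nat \<Rightarrow> real^'n"
    and T :: real
  assumes "\<forall>a b. 0 \<le> P $ a $ b"
    and "spec_radius P < 1"
    and "\<Omega> PID1 \<union> \<Omega> PID2 = UNIV" and "\<Omega> PID1 \<inter> \<Omega> PID2 = {}"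
    and "\<forall>j. local_schedule (\<Omega> j) (s j)"
    and "\<forall>j. fair_on (\<Omega> j) (s j)"
    and "\<forall>j. transmission_times (Ts j) (Tr j)"
    and "\<forall>j. \<forall>n\<ge>1. \<bar>real (Tr j n) - real (Ts j n)\<bar> \<le> T"
    and "\<forall>j. \<forall>n\<ge>1. \<bar>real (Ts j n) - real (Ts j (n - 1))\<bar> \<le> T"
    and "distributed_D_iteration P B \<Omega> s Ts Tr F H"
  shows "(\<forall>\<sigma>. fair_seq \<sigma> \<longrightarrow> D_history P B \<sigma> \<longlonglongrightarrow> matrix_inv (mat 1 - P) *v B)
    \<and> H PID1 \<longlonglongrightarrow> vec_part (\<Omega> PID1) (matrix_inv (mat 1 - P) *v B)
    \<and> H PID2 \<longlonglongrightarrow> vec_part (\<Omega> PID2) (matrix_inv (mat 1 - P) *v B)"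
proof -
  have "distributed_iteration P B \<Omega> s Ts Tr F H"
    using assms by unfold_locales auto
  then have "H j \<longlonglongrightarrow> vec_part (\<Omega> j) (matrix_inv (mat 1 - P) *v B)" for j
    by (rule distributed_iteration.history_tendsto)
  then show ?thesis
    using assms(1,2) by (auto intro: D_history_tendsto)
qed

end
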